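(* Let $\mathbb{T}$ be the set of rooted planar binary trees, and let $D_i$ and $U_i$ ($i\in\mathbb{N}$) be the linear operators on $K\mathbb{T}$ defined in the context. The generating functions $D(t)=\sum_{i\ge 0}D_it^i$ and $U(t')=\sum_{i\ge 0}U_it'^i$ satisfy the equation $$D(t)\,U(t')=\frac{1}{1-tt'}\,U(t')\,D(t).$$ Equivalently, $D(t_1)\cdots D(t_n)$ and $U(t_n)\cdots U(t_1)$ are generalized Schur operators with $\{1,1,1,\ldots\}$.
   Context: Trees. $\mathbb{N}=\{0,1,2,\ldots\}$. Let $F$ be the monoid of words in the alphabet $\{1,2\}$, with the empty word denoted $0$, partially ordered by $v\le vw$ for $v,w\in F$ (prefix order). A (rooted planar binary) tree is a finite order ideal of $F$, i.e. a finite, possibly empty, subset $T\subset F$ closed under taking prefixes; its elements are its nodes. $\mathbb{T}$ is the set of all trees, $\mathbb{T}_i$ the set of trees with $i$ nodes, and $|T|$ is the number of nodes of $T$. The node $v1$ is the left child and $v2$ the right child of $v$. For $v\in F$ put $T_v=\{w\in T: v\le w\}$. $K$ is a field of characteristic zero (containing all formal power series in the variables used), $V_i=K\mathbb{T}_i$ (with $V_i=0$ for $i<0$), $V=K\mathbb{T}=\bigoplus_i V_i$. Up operators. $G_U$ is the set of pairs $(T,T')$ of trees with $T\subset T'$ such that: if $T\ne\emptyset$, each $w\in T'\setminus T$ can be written $w=v1^n$ or $w=v21^n$ for some $v\in T$ and some integer $n\ge 0$; if $T=\emptyset$, each $w\in T'\setminus T$ is of the form $1^n$, $n\ge 0$.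 $G_{U_i}=\{(T,T')\in G_U: |T|+i=|T'|\}$. The linear operator $U_i$ is defined by $U_iT=\sum_{T':(T,T')\in G_{U_i}}T'$. Down operators. For a tree $T$ let $R_T=\{w\in T: w2\notin T\}$. For $w\in R_T$ let $T\circleddash w=(T\setminus T_w)\cup\{wv: w1v\in T_w\}$ (delete $w$ and move its left subtree up into its place). Let $E_T$ be the set of $w\in T$ such that whenever $w=v1w'$ with $v,w'\in F$ one has $v2\notin T$. Let $r_T=E_T\cap R_T$; it is a chain $w_{T,1}<w_{T,2}<\cdots<w_{T,k}$. For $0\le i\le |r_T|$ put $r_{T,i}=\{w_{T,1},\ldots,w_{T,i}\}$, and define $T\ominus r_{T,i}$ inductively by $T\ominus r_{T,0}=T$ and $T\ominus r_{T,i}=(T\circleddash w_{T,i})\ominus r_{T,i-1}$ for $i>0$; that is, apply $\circleddash w_{T,i}$, then $\circleddash w_{T,i-1}$, ..., finally $\circleddash w_{T,1}$. $G_{D_i}=\{(T\ominus r_{T,i},T): T\in\mathbb{T},\ |r_T|\ge i\}$. The linear operator $D_i$ is defined by: $D_iT$ is the tree $T'$ with $(T',T)\in G_{D_i}$, i.e. $D_iT=T\ominus r_{T,i}$, if $|r_T|\ge i$, and $D_iT=0$ otherwise. Generating functions and generalized Schur operators. For a sequence $\{A_i\}$, $A(x)=\sum_{i\ge0}A_ix^i$. Identities between generating functions of operators are identities of formal power series in the variables with coefficients linear operators on $V$. Given a sequence $\{a_m\}$ in $K$, one says that $D(t_1)\cdots D(t_n)$ and $U(t_n)\cdots U(t_1)$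 are generalized Schur operators with $\{a_m\}$ if $U_i,D_i$ are linear maps on $V$ with $U_i(V_j)\subset V_{j+i}$ and $D_i(V_j)\subset V_{j-i}$ for all $i,j$, and $D(t')U(t)=a(tt')U(t)D(t')$. *)

theory Defs
  imports
    "HOL-Library.Sublist"
    "HOL-Library.Poly_Mapping"
    "HOL-Computational_Algebra.Formal_Power_Series"
begin

section \<open>Trees\<close>

text \<open>A node is a word over the alphabet \<open>{1, 2}\<close>; the empty word (the root) is \<open>[]\<close>, and
  the order \<open>v \<le> v w\<close> is the library's \<^const>\<open>prefix\<close>.\<close>

datatype letter = One | Two

type_synonym word = "letter list"

definition order_ideal :: "word set \<Rightarrow> bool" where
  "order_ideal T \<longleftrightarrow> (\<forall>w\<in>T. \<forall>v. prefix v w \<longrightarrow> v \<in> T)"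

typedef tree = "{T :: word set. finite T \<and> order_ideal T}"
  morphisms nodes Tree
  by (rule exI[of _ "{}"]) (simp add: order_ideal_def)

setup_lifting type_definition_tree

abbreviation tree_size :: "tree \<Rightarrow> nat" where
  "tree_size T \<equiv> card (nodes T)"

definition subtree_nodes :: "word set \<Rightarrow> word \<Rightarrow> word set" where
  "subtree_nodes T v = {w \<in> T. prefix v w}"

lemma finite_nodes [simp]: "finite (nodes T)"
  using nodes[of T] by simp

lemma order_ideal_nodes: "order_ideal (nodes T)"
  using nodes[of T] by simp

lemma length_less_tree_size:
  assumes "w \<in> nodes T"
  shows "length w < tree_size T"
proof -
  have "set (prefixes w) \<subseteq> nodes T"
    using order_ideal_nodes[of T] assms by (auto simp: order_ideal_def)
  then have "card (set (prefixes w)) \<le> tree_size T"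
    by (rule card_mono[rotated]) simp
  moreover have "card (set (prefixes w)) = Suc (length w)"
    by (simp add: distinct_card)
  ultimately show ?thesis by simp
qed

lemma finite_trees_of_size: "finite {T. tree_size T = n}"
proof -
  have fin: "finite {w :: word. length w < n}"
  proof -
    have "(UNIV :: letter set) = {One, Two}"
      by (auto intro: letter.exhaust)
    then have "finite (UNIV :: letter set)"
      by (metis finite.emptyI finite.insertI)
    from finite_lists_length_le[OF this, of n] show ?thesis
      by (rule finite_subset[rotated]) auto
  qed
  have "nodes ` {T. tree_size T = n} \<subseteq> Pow {w. length w < n}"
    using length_less_tree_size by blast
  then have "finite (nodes ` {T. tree_size T = n})"
    using fin by (meson finite_Pow_iff finite_subset)
  then show ?thesis
    by (rule finite_imageD) (simp add: inj_on_def nodes_inject)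
qed


section \<open>The vector space spanned by the trees and its linear operators\<close>

text \<open>\<open>K\<T>\<close> is \<^typ>\<open>tree \<Rightarrow>\<^sub>0 'k\<close>, the finitely supported functions from trees to the field.\<close>

definition scale :: "'k::field \<Rightarrow> (tree \<Rightarrow>\<^sub>0 'k) \<Rightarrow> (tree \<Rightarrow>\<^sub>0 'k)" where
  "scale c v = Poly_Mapping.map ((*) c) v"

definition basis :: "tree \<Rightarrow> (tree \<Rightarrow>\<^sub>0 'k::field)" where
  "basis T = Poly_Mapping.single T 1"

lemma lookup_scale [simp]:
  "Poly_Mapping.lookup (scale c v) T = c * Poly_Mapping.lookup v T"
  by (simp add: scale_def Poly_Mapping.map.rep_eq when_def)

global_interpretation tree_space: vector_space scale
  by unfold_locales (auto intro!: poly_mapping_eqI simp: lookup_add algebra_simps)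

text \<open>The homogeneous component \<open>V\<^sub>j\<close>; the index is an integer, so that \<open>V\<^sub>j = 0\<close> for \<open>j < 0\<close>.\<close>

definition V_comp :: "int \<Rightarrow> (tree \<Rightarrow>\<^sub>0 'k::field) set" where
  "V_comp j = {v. \<forall>T \<in> Poly_Mapping.keys v. int (tree_size T) = j}"

typedef (overloaded) 'k tree_op =
  "{f :: (tree \<Rightarrow>\<^sub>0 'k::field) \<Rightarrow> (tree \<Rightarrow>\<^sub>0 'k). Vector_Spaces.linear scale scale f}"
  morphisms apply_op Tree_Op
  by (rule exI[of _ "\<lambda>v. v"]) (simp add: tree_space.linear_ident)

setup_lifting type_definition_tree_op

text \<open>The operators form a ring, with composition as multiplication.\<close>

instantiation tree_op :: (field) ring_1
begin

lift_definition zero_tree_op :: "'a tree_op" is "\<lambda>_. 0"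
  by (simp add: Vector_Spaces.linear_iff tree_space.vector_space_axioms)

lift_definition one_tree_op :: "'a tree_op" is "\<lambda>v. v"
  by (rule tree_space.linear_ident)

lift_definition plus_tree_op :: "'a tree_op \<Rightarrow> 'a tree_op \<Rightarrow> 'a tree_op"
  is "\<lambda>f g v. f v + g v"
  by (auto simp: Vector_Spaces.linear_iff algebra_simps tree_space.scale_right_distrib)

lift_definition minus_tree_op :: "'a tree_op \<Rightarrow> 'a tree_op \<Rightarrow> 'a tree_op"
  is "\<lambda>f g v. f v - g v"
  by (auto simp: Vector_Spaces.linear_iff algebra_simps tree_space.scale_right_diff_distrib)

lift_definition uminus_tree_op :: "'a tree_op \<Rightarrow> 'a tree_op" is "\<lambda>f v. - f v"
  by (auto simp: Vector_Spaces.linear_iff tree_space.scale_minus_right)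

lift_definition times_tree_op :: "'a tree_op \<Rightarrow> 'a tree_op \<Rightarrow> 'a tree_op"
  is "\<lambda>f g v. f (g v)"
  by (auto simp: Vector_Spaces.linear_iff)

instance
proof
  show "(0 :: 'a tree_op) \<noteq> 1"
  proof
    assume "(0 :: 'a tree_op) = 1"
    then have "apply_op (0 :: 'a tree_op) (basis T) = apply_op 1 (basis T)" for T
      by simp
    then have "(0 :: tree \<Rightarrow>\<^sub>0 'a) = basis T" for T
      by (simp add: zero_tree_op.rep_eq one_tree_op.rep_eq)
    then have "Poly_Mapping.lookup (0 :: tree \<Rightarrow>\<^sub>0 'a) T = Poly_Mapping.lookup (basis T) T" for T
      by metis
    then show False by (simp add: basis_def)
  qed
qed (transfer; auto simp: fun_eq_iff Vector_Spaces.linear_iff)+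

end

lift_definition scalar_op :: "'k::field \<Rightarrow> 'k tree_op" is scale
  by (rule tree_space.linear_scale_self)

lemma linear_sum_keys:
  fixes f :: "tree \<Rightarrow> (tree \<Rightarrow>\<^sub>0 'k::field)"
  shows "Vector_Spaces.linear scale scale
    (\<lambda>v. \<Sum>T \<in> Poly_Mapping.keys v. scale (Poly_Mapping.lookup v T) (f T))"
proof -
  define g where
    "g v = (\<Sum>T \<in> Poly_Mapping.keys v. scale (Poly_Mapping.lookup v T) (f T))" for v
  have g: "g v = (\<Sum>T \<in> A. scale (Poly_Mapping.lookup v T) (f T))"
    if "finite A" "Poly_Mapping.keys v \<subseteq> A" for v A
    unfolding g_def using that
    by (intro sum.mono_neutral_left) (auto simp: in_keys_iff)
  have "g (v + w) = g v + g w" for v w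
    using keys_add[of v w]
    by (simp add: g[of "Poly_Mapping.keys v \<union> Poly_Mapping.keys w"]
        lookup_add tree_space.scale_left_distrib sum.distrib)
  moreover have "g (scale c v) = scale c (g v)" for c v
  proof -
    have "Poly_Mapping.keys (scale c v) \<subseteq> Poly_Mapping.keys v"
      by (auto simp: in_keys_iff)
    then show ?thesis
      by (simp add: g[of "Poly_Mapping.keys v"] tree_space.scale_sum_right)
  qed
  ultimately have "Vector_Spaces.linear scale scale g"
    by (simp add: Vector_Spaces.linear_iff tree_space.vector_space_axioms)
  then show ?thesis
    by (simp add: g_def[abs_def])
qed

definition linear_extension ::
  "(tree \<Rightarrow> (tree \<Rightarrow>\<^sub>0 'k::field)) \<Rightarrow> 'k tree_op" where
  "linear_extension f =
    Tree_Op (\<lambda>v. \<Sum>T \<in> Poly_Mapping.keys v. scale (Poly_Mapping.lookup v T) (f T))"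

lemma apply_linear_extension:
  "apply_op (linear_extension f) v =
    (\<Sum>T \<in> Poly_Mapping.keys v. scale (Poly_Mapping.lookup v T) (f T))"
  unfolding linear_extension_def by (subst Tree_Op_inverse) (simp_all add: linear_sum_keys)

lemma linear_extension_basis [simp]: "apply_op (linear_extension f) (basis T) = f T"
  by (simp add: apply_linear_extension basis_def)


section \<open>Up operators\<close>

definition G_U :: "(tree \<times> tree) set" where
  "G_U = {(T, T'). nodes T \<subseteq> nodes T' \<and>
     (if nodes T = {} then \<forall>w \<in> nodes T' - nodes T. \<exists>n. w = replicate n One
      else \<forall>w \<in> nodes T' - nodes T. \<exists>v \<in> nodes T. \<exists>n.
             w = v @ replicate n One \<or> w = v @ [Two] @ replicate n One)}"

definition G_U_deg :: "nat \<Rightarrow> (tree \<times> tree) set" where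
  "G_U_deg i = {(T, T') \<in> G_U. tree_size T + i = tree_size T'}"

lemma finite_G_U_deg: "finite {T'. (T, T') \<in> G_U_deg i}"
  by (rule finite_subset[OF _ finite_trees_of_size[of "tree_size T + i"]])
    (auto simp: G_U_deg_def)

definition up_op :: "nat \<Rightarrow> 'k::field tree_op" where
  "up_op i = linear_extension (\<lambda>T. \<Sum>T' | (T, T') \<in> G_U_deg i. basis T')"


section \<open>Down operators\<close>

definition R_nodes :: "tree \<Rightarrow> word set" where
  "R_nodes T = {w \<in> nodes T. w @ [Two] \<notin> nodes T}"

lift_definition remove_node :: "tree \<Rightarrow> word \<Rightarrow> tree"
  is "\<lambda>T w. (T - subtree_nodes T w) \<union> {w @ v | v. w @ [One] @ v \<in> subtree_nodes T w}"
proof -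
  fix T :: "word set" and w :: word
  assume T: "finite T \<and> order_ideal T"
  have "{w @ v | v. w @ [One] @ v \<in> subtree_nodes T w} \<subseteq>
      (\<lambda>u. w @ drop (Suc (length w)) u) ` T"
    by (force simp: subtree_nodes_def image_iff)
  then have "finite {w @ v | v. w @ [One] @ v \<in> subtree_nodes T w}"
    using T by (meson finite_imageI finite_subset)
  moreover have "order_ideal
      ((T - subtree_nodes T w) \<union> {w @ v | v. w @ [One] @ v \<in> subtree_nodes T w})"
    unfolding order_ideal_def
  proof (intro ballI allI impI)
    fix x u
    assume x: "x \<in> (T - subtree_nodes T w) \<union> {w @ v | v. w @ [One] @ v \<in> subtree_nodes T w}"
      and u: "prefix u x"
    have closed: "b \<in> T \<Longrightarrow> prefix a b \<Longrightarrow> a \<in> T" for a b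
      using T by (auto simp: order_ideal_def)
    from x show "u \<in> (T - subtree_nodes T w) \<union> {w @ v | v. w @ [One] @ v \<in> subtree_nodes T w}"
    proof
      assume "x \<in> T - subtree_nodes T w"
      then show ?thesis
        using u closed[of x u] by (auto simp: subtree_nodes_def dest: prefix_order.trans)
    next
      assume "x \<in> {w @ v | v. w @ [One] @ v \<in> subtree_nodes T w}"
      then obtain v where v: "x = w @ v" "w @ [One] @ v \<in> T"
        by (auto simp: subtree_nodes_def)
      show ?thesis
      proof (cases "prefix w u")
        case True
        then obtain v' where v': "u = w @ v'" by (auto elim: prefixE)
        then have "prefix v' v" using u v by simp
        then have "w @ [One] @ v' \<in> T" using closed[OF v(2)] by simp
        then show ?thesis using v' by (auto simp: subtree_nodes_def)
      next
        case False
        then have "prefix u w" using u v by (auto simp: prefix_append)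
        then have "u \<in> T" using closed[OF v(2)] by simp
        then show ?thesis using False by (auto simp: subtree_nodes_def)
      qed
    qed
  qed
  ultimately show "finite ((T - subtree_nodes T w) \<union>
        {w @ v | v. w @ [One] @ v \<in> subtree_nodes T w}) \<and>
      order_ideal ((T - subtree_nodes T w) \<union>
        {w @ v | v. w @ [One] @ v \<in> subtree_nodes T w})"
    using T by simp
qed

definition E_nodes :: "tree \<Rightarrow> word set" where
  "E_nodes T = {w \<in> nodes T. \<forall>v w'. w = v @ [One] @ w' \<longrightarrow> v @ [Two] \<notin> nodes T}"

definition r_nodes :: "tree \<Rightarrow> word set" where
  "r_nodes T = E_nodes T \<inter> R_nodes T"

text \<open>The increasing enumeration \<open>w\<^sub>1 < \<dots> < w\<^sub>k\<close> of the chain \<open>r\<^sub>T\<close>, as a list.\<close>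

definition r_list :: "tree \<Rightarrow> word list" where
  "r_list T = (THE ws. sorted_wrt strict_prefix ws \<and> set ws = r_nodes T)"

lemma finite_r_nodes [simp]: "finite (r_nodes T)"
  by (rule finite_subset[OF _ finite_nodes[of T]]) (auto simp: r_nodes_def R_nodes_def)

lemma r_nodes_chain:
  assumes "u \<in> r_nodes T" "w \<in> r_nodes T"
  shows "prefix u w \<or> prefix w u"
proof (rule ccontr)
  assume "\<not> ?thesis"
  then have "u \<parallel> w" by (simp add: parallel_def)
  then obtain p a us b ws where dec: "a \<noteq> b" "u = p @ a # us" "w = p @ b # ws"
    using parallel_decomp by blast
  have False if "x \<in> r_nodes T" "y \<in> r_nodes T" "x = p @ One # xs" "y = p @ Two # ys" for x y xs ys
  proof -
    have "prefix (p @ [Two]) y" "y \<in> nodes T"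
      using that by (auto simp: r_nodes_def R_nodes_def)
    then have "p @ [Two] \<in> nodes T"
      using order_ideal_nodes[of T] by (auto simp: order_ideal_def)
    then show False using that by (auto simp: r_nodes_def E_nodes_def)
  qed
  then show False
    using assms dec by (cases a; cases b) blast+
qed

lemma ex1_r_list: "\<exists>!ws. sorted_wrt strict_prefix ws \<and> set ws = r_nodes T"
proof (rule ex_ex1I)
  have inj: "inj_on length (r_nodes T)"
    using r_nodes_chain by (fastforce simp: inj_on_def prefix_def)
  obtain xs where xs: "set xs = r_nodes T" "distinct xs"
    using finite_distinct_list[of "r_nodes T"] by auto
  define ws where "ws = sort_key length xs"
  have set: "set ws = r_nodes T" by (simp add: ws_def xs)
  have "distinct (map length ws)"
    using inj by (simp add: ws_def xs distinct_map)
  then have "sorted_wrt (<) (map length ws)"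
    by (simp add: strict_sorted_iff ws_def)
  then have "sorted_wrt (\<lambda>x y. length x < length y) ws"
    by (simp add: sorted_wrt_map)
  then have "sorted_wrt strict_prefix ws"
    by (rule sorted_wrt_mono_rel[rotated])
      (use r_nodes_chain set in \<open>fastforce simp: prefix_def strict_prefix_def\<close>)
  with set show "\<exists>ws. sorted_wrt strict_prefix ws \<and> set ws = r_nodes T" by blast
next
  fix xs ys
  assume xs: "sorted_wrt strict_prefix xs \<and> set xs = r_nodes T"
    and ys: "sorted_wrt strict_prefix ys \<and> set ys = r_nodes T"
  have inj: "inj_on length (r_nodes T)"
    using r_nodes_chain by (fastforce simp: inj_on_def prefix_def)
  have less: "sorted_wrt (<) (map length zs)" if "sorted_wrt strict_prefix zs" for zs :: "word list"
    using that by (auto simp: sorted_wrt_map prefix_length_less elim: sorted_wrt_mono_rel[rotated])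
  have "map length xs = map length ys"
    using less[of xs] less[of ys] xs ys
    by (intro sorted_distinct_set_unique) (auto simp: strict_sorted_iff)
  then show "xs = ys"
    using xs ys inj by (simp add: inj_on_map_eq_map)
qed

lemma r_list: "sorted_wrt strict_prefix (r_list T)" "set (r_list T) = r_nodes T"
  using theI'[OF ex1_r_list[of T]] by (simp_all add: r_list_def)

text \<open>\<open>remove_initial ws i T\<close> applies \<^const>\<open>remove_node\<close> with the \<open>i\<close>-th entry of \<open>ws\<close> first
  and with the first entry last. The list is 0-based, so \<open>w\<^sub>i\<close> is \<open>ws ! (i - 1)\<close>.\<close>

primrec remove_initial :: "word list \<Rightarrow> nat \<Rightarrow> tree \<Rightarrow> tree" where
  "remove_initial ws 0 T = T"
| "remove_initial ws (Suc i) T = remove_initial ws i (remove_node T (ws ! i))"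

definition G_D_deg :: "nat \<Rightarrow> (tree \<times> tree) set" where
  "G_D_deg i = {(remove_initial (r_list T) i T, T) | T. i \<le> card (r_nodes T)}"

definition down_op :: "nat \<Rightarrow> 'k::field tree_op" where
  "down_op i = linear_extension (\<lambda>T. if i \<le> card (r_nodes T)
     then basis (THE T'. (T', T) \<in> G_D_deg i) else 0)"

lemma down_op_basis:
  "apply_op (down_op i) (basis T) =
    (if i \<le> card (r_nodes T) then basis (remove_initial (r_list T) i T) else 0)"
  by (auto simp: down_op_def G_D_deg_def)


section \<open>Generating functions\<close>

text \<open>Formal power series in two commuting variables with coefficients in a ring \<open>R\<close> are
  iterated series \<open>R[[y]][[x]]\<close>: the coefficient of \<open>x\<^sup>i y\<^sup>j\<close> in \<open>F\<close> is \<open>F $ i $ j\<close>. The two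
  generating functions below place a sequence in \<open>R[[x]]\<close> and in \<open>R[[y]]\<close>, respectively.\<close>

unbundle fps_syntax

definition var_x :: "'r::ring_1 fps fps" where
  "var_x = fps_X"

definition var_y :: "'r::ring_1 fps fps" where
  "var_y = fps_const fps_X"

definition gen_x :: "(nat \<Rightarrow> 'r::ring_1) \<Rightarrow> 'r fps fps" where
  "gen_x A = Abs_fps (\<lambda>i. fps_const (A i))"

definition gen_y :: "(nat \<Rightarrow> 'r::ring_1) \<Rightarrow> 'r fps fps" where
  "gen_y A = fps_const (Abs_fps A)"

text \<open>A scalar series, viewed as a series with operator coefficients.\<close>

definition scalar_series :: "'k::field fps fps \<Rightarrow> 'k tree_op fps fps" where
  "scalar_series F = Abs_fps (\<lambda>i. Abs_fps (\<lambda>j. scalar_op (F $ i $ j)))"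

text \<open>\<open>series_at a z\<close> is \<open>a(z)\<close>, the sum of \<open>a\<^sub>m z\<^sup>m\<close>, for \<open>z\<close> without constant term in \<open>x\<close>.\<close>

definition series_at :: "(nat \<Rightarrow> 'k::field) \<Rightarrow> 'k fps fps \<Rightarrow> 'k fps fps" where
  "series_at a z = fps_compose (Abs_fps (\<lambda>m. fps_const (a m))) z"

text \<open>The defining conditions do not involve the number \<open>n\<close> of factors in
  \<open>D(t\<^sub>1) \<dots> D(t\<^sub>n)\<close> and \<open>U(t\<^sub>n) \<dots> U(t\<^sub>1)\<close>; here \<open>t' = x\<close> and \<open>t = y\<close>.\<close>

definition generalized_schur_operators ::
  "(nat \<Rightarrow> 'k::field tree_op) \<Rightarrow> (nat \<Rightarrow> 'k tree_op) \<Rightarrow> (nat \<Rightarrow> 'k) \<Rightarrow> bool" where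
  "generalized_schur_operators D U a \<longleftrightarrow>
     (\<forall>i j. apply_op (U i) ` V_comp j \<subseteq> V_comp (j + int i)) \<and>
     (\<forall>i j. apply_op (D i) ` V_comp j \<subseteq> V_comp (j - int i)) \<and>
     gen_x D * gen_y U = scalar_series (series_at a (var_x * var_y)) * gen_y U * gen_x D"

lemma nth_var_xy_power:
  "((var_x * var_y :: 'r::comm_ring_1 fps fps) ^ m) $ i $ j = (if i = m \<and> j = m then 1 else 0)"
proof -
  have "(var_x * var_y :: 'r fps fps) ^ m = fps_X ^ m * fps_const (fps_X ^ m)"
    by (simp add: var_x_def var_y_def power_mult_distrib fps_const_power)
  then show ?thesis
    by (auto simp: fps_X_power_mult_nth fps_X_power_nth)
qed

lemma nth_series_at:
  "series_at a (var_x * var_y) $ i $ j = (if i = j then a i else 0)"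
proof -
  have "series_at a (var_x * var_y) $ i $ j =
      (\<Sum>k = 0..i. a k * (if i = k \<and> j = k then 1 else 0))"
    by (simp add: series_at_def fps_compose_nth fps_sum_nth nth_var_xy_power)
  also have "\<dots> = (\<Sum>k = 0..i. if k = i then if i = j then a i else 0 else 0)"
    by (rule sum.cong) auto
  finally show ?thesis by simp
qed

lemma inverse_one_minus_var_xy:
  "1 / (1 - var_x * var_y) = (series_at (\<lambda>_. 1) (var_x * var_y) :: 'k::field fps fps)"
proof -
  let ?g = "1 - var_x * var_y :: 'k fps fps"
  let ?s = "series_at (\<lambda>_. 1) (var_x * var_y) :: 'k fps fps"
  have g0: "?g $ 0 = 1"
    by (simp add: var_x_def var_y_def)
  have "?g * inverse ?g = 1"
    unfolding fps_inverse_def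
    by (rule fps_right_inverse) (simp only: g0, simp add: fps_lr_inverse_one_one)
  moreover have "?g * ?s = 1"
  proof (rule fps_ext, rule fps_ext)
    fix i j
    have "(var_x * var_y * ?s) $ i $ j = (if i = 0 \<or> j = 0 then 0 else ?s $ (i - 1) $ (j - 1))"
      by (simp add: var_x_def var_y_def mult.assoc)
    then show "(?g * ?s) $ i $ j = 1 $ i $ j"
      by (auto simp: left_diff_distrib nth_series_at)
  qed
  ultimately have "inverse ?g = (?g * inverse ?g) * ?s" "?g * inverse ?g = 1"
    using mult.assoc[of "inverse ?g" ?g ?s] mult.commute[of ?g "inverse ?g"] by simp_all
  then have "inverse ?g = ?s" by simp
  moreover have "subdegree ?g = 0"
    by (rule subdegree_eq_0) (simp only: g0, simp)
  ultimately show ?thesis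
    by (simp add: fps_divide_def)
qed

lemma nth_gen_prod:
  "(gen_x D * gen_y U) $ i $ j = D i * U j"
  "(gen_y U * gen_x D) $ i $ j = U j * D i"
  by (simp_all add: gen_x_def gen_y_def)

end

theory Submission
  imports Defs
begin

text \<open>Both families of operators are recursive in the left and right subtrees of the root. Since
  \<open>U\<close> hangs a left chain of arbitrary length into each empty slot, \<open>U(t')\<close> maps a tree with
  subtrees \<open>L\<close>, \<open>R\<close> to the bilinear grafting of \<open>U(t') L\<close> and \<open>U(t') R\<close>. The chain of removable
  nodes runs through \<open>R\<close> unless \<open>R\<close> is empty, in which case it consists of the root followed by the
  chain of \<open>L\<close>; hence \<open>D(t)\<close> sends the tree to the grafting of \<open>L\<close> and \<open>D(t) R\<close> if \<open>R\<close> is nonempty,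
  and to itself plus \<open>t D(t) L\<close> otherwise. The commutation relation
  \<open>D\<^sub>i\<^sub>+\<^sub>1 U\<^sub>j = U\<^sub>j D\<^sub>i\<^sub>+\<^sub>1 + D\<^sub>i U\<^sub>j\<^sub>-\<^sub>1\<close>, which is the theorem multiplied by \<open>1 - t t'\<close>, then follows by
  induction on the tree.\<close>

section \<open>The recursive structure of trees\<close>

lift_definition empty_tree :: tree is "{}"
  by (simp add: order_ideal_def)

lift_definition node :: "tree \<Rightarrow> tree \<Rightarrow> tree"
  is "\<lambda>L R. insert [] ((#) One ` L \<union> (#) Two ` R)"
  by (auto simp: order_ideal_def prefix_Cons)

lemma nodes_empty_tree [simp]: "nodes empty_tree = {}"
  by (rule empty_tree.rep_eq)

lemma nodes_eq_empty_iff: "nodes T = {} \<longleftrightarrow> T = empty_tree"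
  by (metis nodes_empty_tree nodes_inject)

lemma nodes_node_iff [simp]:
  "[] \<in> nodes (node L R)"
  "One # w \<in> nodes (node L R) \<longleftrightarrow> w \<in> nodes L"
  "Two # w \<in> nodes (node L R) \<longleftrightarrow> w \<in> nodes R"
  by (auto simp: node.rep_eq)

lemma tree_eqI: "(\<And>w. w \<in> nodes S \<longleftrightarrow> w \<in> nodes T) \<Longrightarrow> S = T"
  by (metis nodes_inject set_eqI)

lemma word_cases: obtains "w = []" | u where "w = One # u" | u where "w = Two # u"
  by (metis letter.exhaust list.exhaust)

lemma all_word_iff:
  "(\<forall>w :: word. P w) \<longleftrightarrow> P [] \<and> (\<forall>w. P (One # w)) \<and> (\<forall>w. P (Two # w))"
  by (metis word_cases)

lemma node_eqI:
  assumes "[] \<in> nodes T" "\<And>w. One # w \<in> nodes T \<longleftrightarrow> w \<in> nodes L"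
    "\<And>w. Two # w \<in> nodes T \<longleftrightarrow> w \<in> nodes R"
  shows "T = node L R"
proof (rule tree_eqI)
  show "w \<in> nodes T \<longleftrightarrow> w \<in> nodes (node L R)" for w
    using assms by (cases w rule: word_cases) auto
qed

lemma node_inject [simp]: "node L R = node L' R' \<longleftrightarrow> L = L' \<and> R = R'"
  by (metis nodes_node_iff(2,3) tree_eqI)

lemma node_neq_empty_tree [simp]: "node L R \<noteq> empty_tree" "empty_tree \<noteq> node L R"
  by (metis empty_iff nodes_empty_tree nodes_node_iff(1))+

lemma tree_size_node [simp]: "tree_size (node L R) = Suc (tree_size L + tree_size R)"
  by (subst node.rep_eq, subst card_insert_disjoint, simp, force)
    (subst card_Un_disjoint; auto simp: card_image)

lemma tree_exhaust:
  obtains "T = empty_tree" | L R where "T = node L R"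
proof (cases "T = empty_tree")
  case False
  then obtain w where "w \<in> nodes T"
    using nodes_eq_empty_iff by blast
  then have root: "[] \<in> nodes T"
    using order_ideal_nodes[of T] by (auto simp: order_ideal_def)
  define child where "child a = Tree {w. a # w \<in> nodes T}" for a
  have "w \<in> nodes (child a) \<longleftrightarrow> a # w \<in> nodes T" for a w
  proof -
    have "finite {w. a # w \<in> nodes T}"
      by (rule finite_vimageI[of "nodes T" "(#) a", unfolded vimage_def]) auto
    moreover have "order_ideal {w. a # w \<in> nodes T}"
      using order_ideal_nodes[of T] by (auto simp: order_ideal_def)
    ultimately show ?thesis
      unfolding child_def by (subst Tree_inverse) auto
  qed
  then have "T = node (child One) (child Two)"
    using root by (intro node_eqI) auto
  then show ?thesis using that by blast
qed

lemma tree_induct [case_names empty_tree node]: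
  assumes "P empty_tree" "\<And>L R. P L \<Longrightarrow> P R \<Longrightarrow> P (node L R)"
  shows "P T"
proof (induction T rule: measure_induct_rule[of tree_size])
  case (less T)
  show ?case
    using assms less by (cases T rule: tree_exhaust) auto
qed


section \<open>Up operators\<close>

text \<open>The clause of \<open>G_U\<close> for a single new node. It mentions only the old tree
  and the word, so it can be followed one letter at a time.\<close>

definition up_word :: "tree \<Rightarrow> word \<Rightarrow> bool" where
  "up_word T w \<longleftrightarrow> (if T = empty_tree then \<exists>n. w = replicate n One
     else \<exists>v \<in> nodes T. \<exists>n. w = v @ replicate n One \<or> w = v @ [Two] @ replicate n One)"

lemma G_U_iff:
  "(T, T') \<in> G_U \<longleftrightarrow> nodes T \<subseteq> nodes T' \<and> (\<forall>w \<in> nodes T' - nodes T. up_word T w)"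
  by (auto simp: G_U_def up_word_def nodes_eq_empty_iff)

lemma root_in_nodes: "T \<noteq> empty_tree \<Longrightarrow> [] \<in> nodes T"
  by (metis nodes_node_iff(1) tree_exhaust)

lemma Cons_eq_replicate: "a # u = replicate n b \<longleftrightarrow> a = b \<and> (\<exists>m. n = Suc m \<and> u = replicate m b)"
  by (cases n) auto

lemma bex_nodes_node:
  "(\<exists>v \<in> nodes (node L R). P v) \<longleftrightarrow>
     P [] \<or> (\<exists>v \<in> nodes L. P (One # v)) \<or> (\<exists>v \<in> nodes R. P (Two # v))"
  by (auto simp: node.rep_eq)

lemma ball_nodes_node:
  "(\<forall>v \<in> nodes (node L R). P v) \<longleftrightarrow>
     P [] \<and> (\<forall>v \<in> nodes L. P (One # v)) \<and> (\<forall>v \<in> nodes R. P (Two # v))"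
  by (auto simp: node.rep_eq)

text \<open>If a subtree is empty, its new nodes hang from the root as a left chain, which is what
  the empty case of \<open>up_word\<close> allows. If it is nonempty, its own root accounts for that
  same chain.\<close>

lemma up_word_node:
  "up_word (node L R) (One # u) \<longleftrightarrow> up_word L u"
  "up_word (node L R) (Two # u) \<longleftrightarrow> up_word R u"
  by (auto simp: up_word_def bex_nodes_node Cons_eq_replicate dest: root_in_nodes
      intro: bexI[of _ "[]"])

lemma G_U_node_iff:
  "(node L R, T') \<in> G_U \<longleftrightarrow> (\<exists>L' R'. T' = node L' R' \<and> (L, L') \<in> G_U \<and> (R, R') \<in> G_U)"
proof (cases T' rule: tree_exhaust)
  case 1
  then show ?thesis by (auto simp: G_U_def node.rep_eq)
next
  case (2 L' R')
  show ?thesis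
    unfolding G_U_iff subset_iff Ball_def 2 by (subst (1 2) all_word_iff) (auto simp: up_word_node)
qed

lemma G_U_empty_tree_node_iff:
  "(empty_tree, node L R) \<in> G_U \<longleftrightarrow> R = empty_tree \<and> (empty_tree, L) \<in> G_U"
proof -
  have "(\<forall>w \<in> nodes (node L R). up_word empty_tree w) \<longleftrightarrow>
      (\<forall>w \<in> nodes L. up_word empty_tree w) \<and> nodes R = {}"
    by (auto simp: ball_nodes_node up_word_def Cons_eq_replicate intro: exI[of _ 0])
  then show ?thesis by (auto simp: G_U_iff nodes_eq_empty_iff)
qed

primrec left_chain :: "nat \<Rightarrow> tree" where
  "left_chain 0 = empty_tree"
| "left_chain (Suc n) = node (left_chain n) empty_tree"

lemma tree_size_left_chain [simp]: "tree_size (left_chain n) = n"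
  by (induction n) auto

lemma G_U_empty_tree_iff: "(empty_tree, T) \<in> G_U \<longleftrightarrow> (\<exists>n. T = left_chain n)"
proof (induction T rule: tree_induct)
  case empty_tree
  show ?case by (auto simp: G_U_iff intro: exI[of _ 0])
next
  case (node L R)
  have "(\<exists>n. node L R = left_chain n) \<longleftrightarrow> R = empty_tree \<and> (\<exists>n. L = left_chain n)"
    by (metis left_chain.simps node_inject node_neq_empty_tree(1) not0_implies_Suc)
  with node show ?case by (simp add: G_U_empty_tree_node_iff)
qed

abbreviation ups :: "nat \<Rightarrow> tree \<Rightarrow> tree set" where
  "ups j T \<equiv> {T'. (T, T') \<in> G_U_deg j}"

lemma ups_empty_tree: "ups j empty_tree = {left_chain j}"
  by (auto simp: G_U_deg_def G_U_empty_tree_iff)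

lemma sum_ups_node:
  "(\<Sum>T' \<in> ups j (node L R). f T') =
     (\<Sum>a\<le>j. \<Sum>L' \<in> ups a L. \<Sum>R' \<in> ups (j - a) R. f (node L' R'))"
proof -
  let ?A = "SIGMA a:{..j}. ups a L \<times> ups (j - a) R"
  have inj: "inj_on (\<lambda>(a, L', R'). node L' R') ?A"
    by (auto simp: inj_on_def G_U_deg_def)
  have size: "tree_size T \<le> tree_size T'" if "(T, T') \<in> G_U" for T T'
    using that by (auto simp: G_U_def intro: card_mono)
  have image: "(\<lambda>(a, L', R'). node L' R') ` ?A = ups j (node L R)"
  proof (intro equalityI subsetI)
    fix T' assume "T' \<in> ups j (node L R)"
    then obtain L' R' where "T' = node L' R'" "(L, L') \<in> G_U" "(R, R') \<in> G_U"
        "tree_size L + tree_size R + j = tree_size L' + tree_size R'"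
      by (auto simp: G_U_deg_def G_U_node_iff)
    \<comment> \<open>The number of new nodes that fall into the left subtree. The truncated
      subtraction is exact because \<open>L'\<close> contains \<open>L\<close>.\<close>
    moreover from this have "(tree_size L' - tree_size L, L', R') \<in> ?A"
      using size[of L L'] size[of R R'] by (auto simp: G_U_deg_def)
    ultimately show "T' \<in> (\<lambda>(a, L', R'). node L' R') ` ?A" by force
  qed (auto simp: G_U_deg_def G_U_node_iff)
  have "(\<Sum>T' \<in> ups j (node L R). f T') = (\<Sum>(a, L', R') \<in> ?A. f (node L' R'))"
    unfolding image[symmetric] sum.reindex[OF inj] by (simp add: case_prod_unfold)
  also have "\<dots> = (\<Sum>a\<le>j. \<Sum>(L', R') \<in> ups a L \<times> ups (j - a) R. f (node L' R'))"
    by (rule sum.Sigma[symmetric]) (auto simp: finite_G_U_deg)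
  finally show ?thesis
    by (simp add: sum.cartesian_product)
qed


section \<open>Down operators\<close>

text \<open>In the condition on decompositions \<open>w = v @ [One] @ w'\<close>, the choice
  \<open>v = []\<close> matters only for words starting with \<open>One\<close>, where it forces an
  empty right subtree. Longer \<open>v\<close> give the condition inside the subtree.\<close>

lemma E_nodes_iff:
  "[] \<in> E_nodes T \<longleftrightarrow> [] \<in> nodes T"
  "One # w \<in> E_nodes (node L R) \<longleftrightarrow> w \<in> E_nodes L \<and> R = empty_tree"
  "Two # w \<in> E_nodes (node L R) \<longleftrightarrow> w \<in> E_nodes R"
proof -
  show "[] \<in> E_nodes T \<longleftrightarrow> [] \<in> nodes T" by (simp add: E_nodes_def)
  show "One # w \<in> E_nodes (node L R) \<longleftrightarrow> w \<in> E_nodes L \<and> R = empty_tree"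
    unfolding E_nodes_def mem_Collect_eq
    by (subst all_word_iff) (use root_in_nodes in \<open>auto simp: nodes_eq_empty_iff\<close>)
  show "Two # w \<in> E_nodes (node L R) \<longleftrightarrow> w \<in> E_nodes R"
    unfolding E_nodes_def mem_Collect_eq by (subst all_word_iff) auto
qed

lemma R_nodes_iff:
  "[] \<in> R_nodes (node L R) \<longleftrightarrow> R = empty_tree"
  "One # w \<in> R_nodes (node L R) \<longleftrightarrow> w \<in> R_nodes L"
  "Two # w \<in> R_nodes (node L R) \<longleftrightarrow> w \<in> R_nodes R"
  using root_in_nodes by (auto simp: R_nodes_def)

lemma set_eq_wordI:
  assumes "[] \<in> A \<longleftrightarrow> [] \<in> B" "\<And>w. One # w \<in> A \<longleftrightarrow> One # w \<in> B" "\<And>w. Two # w \<in> A \<longleftrightarrow> Two # w \<in> B"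
  shows "A = B"
  using assms by (metis set_eqI word_cases)

lemma r_nodes_empty_tree: "r_nodes empty_tree = {}"
  by (simp add: r_nodes_def R_nodes_def)

lemma r_nodes_node:
  "r_nodes (node L empty_tree) = insert [] ((#) One ` r_nodes L)"
  "R \<noteq> empty_tree \<Longrightarrow> r_nodes (node L R) = (#) Two ` r_nodes R"
  by (rule set_eq_wordI; auto simp: r_nodes_def E_nodes_iff R_nodes_iff R_nodes_def dest: root_in_nodes)+

lemma r_list_eqI: "sorted_wrt strict_prefix ws \<Longrightarrow> set ws = r_nodes T \<Longrightarrow> r_list T = ws"
  using ex1_r_list[of T] r_list[of T] by blast

lemma r_list_node:
  "r_list (node L empty_tree) = [] # map ((#) One) (r_list L)"
  "R \<noteq> empty_tree \<Longrightarrow> r_list (node L R) = map ((#) Two) (r_list R)"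
  by (rule r_list_eqI; simp add: r_list r_nodes_node sorted_wrt_map)+

lemma length_r_list: "length (r_list T) = card (r_nodes T)"
proof -
  have "sorted_wrt strict_prefix ws \<Longrightarrow> distinct ws" for ws :: "word list"
    by (induction ws) auto
  then have "distinct (r_list T)"
    using r_list(1) by blast
  then show ?thesis by (metis distinct_card r_list(2))
qed

text \<open>Deleting the root discards the right subtree. The down operators delete the root only
  when that subtree is empty.\<close>

lemma remove_node_node:
  "remove_node (node L R) [] = L"
  "remove_node (node L R) (One # w) = node (remove_node L w) R"
  "remove_node (node L R) (Two # w) = node L (remove_node R w)"
proof -
  show "remove_node (node L R) [] = L"
    by (rule tree_eqI) (auto simp: remove_node.rep_eq subtree_nodes_def)
qed (rule node_eqI; auto simp: remove_node.rep_eq subtree_nodes_def)+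

lemma remove_initial_map:
  assumes "i \<le> length ws"
  shows "remove_initial (map ((#) One) ws) i (node L R) = node (remove_initial ws i L) R"
    and "remove_initial (map ((#) Two) ws) i (node L R) = node L (remove_initial ws i R)"
  using assms by (induction i arbitrary: L R) (auto simp: remove_node_node)

text \<open>The defining recursion peels off the deepest removed node, which goes first. Peeling off
  the topmost one, which goes last, is what a recursion at the root calls for.\<close>

lemma remove_initial_Cons:
  "remove_initial (w # ws) (Suc i) T = remove_node (remove_initial ws i T) w"
  by (induction i arbitrary: T) auto

text \<open>Meaningful only for \<open>i \<le> card (r_nodes T)\<close>; beyond that the list is
  indexed out of range.\<close>

definition down_tree :: "nat \<Rightarrow> tree \<Rightarrow> tree" where
  "down_tree i T = remove_initial (r_list T) i T"

text \<open>With an empty right subtree, the \<open>i\<close> deeper deletions turn \<open>L\<close>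
  into \<open>down_tree i L\<close>; deleting the root then exposes that tree. Hence the index drops
  by one.\<close>

lemma down_tree_node:
  "down_tree 0 T = T"
  "i \<le> card (r_nodes L) \<Longrightarrow> down_tree (Suc i) (node L empty_tree) = down_tree i L"
  "R \<noteq> empty_tree \<Longrightarrow> i \<le> card (r_nodes R) \<Longrightarrow> down_tree i (node L R) = node L (down_tree i R)"
  by (simp_all add: down_tree_def r_list_node remove_initial_Cons remove_initial_map
      remove_node_node length_r_list del: remove_initial.simps(2))

lemma card_r_nodes_node:
  "card (r_nodes (node L empty_tree)) = Suc (card (r_nodes L))"
  "R \<noteq> empty_tree \<Longrightarrow> card (r_nodes (node L R)) = card (r_nodes R)"
  by (simp_all add: length_r_list[symmetric] r_list_node)

lemma tree_size_down_tree:
  "i \<le> card (r_nodes T) \<Longrightarrow> tree_size (down_tree i T) + i = tree_size T"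
proof (induction T arbitrary: i rule: tree_induct)
  case empty_tree
  then show ?case by (simp add: r_nodes_empty_tree down_tree_node)
next
  case (node L R)
  show ?case
  proof (cases "R = empty_tree")
    case True
    then show ?thesis
      using node by (cases i) (auto simp: down_tree_node card_r_nodes_node)
  next
    case False
    then show ?thesis
      using node by (auto simp: down_tree_node card_r_nodes_node)
  qed
qed


section \<open>Linear operators on the space of trees\<close>

lemma apply_op_linear: "Vector_Spaces.linear scale scale (apply_op f)"
  using apply_op[of f] by simp

lemma apply_op_hom:
  "apply_op f 0 = 0"
  "apply_op f (v + w) = apply_op f v + apply_op f w"
  "apply_op f (scale c v) = scale c (apply_op f v)"
  "apply_op f (sum g A) = (\<Sum>x\<in>A. apply_op f (g x))"
  using apply_op_linear[of f]
  by (auto simp: linear_iff_module_hom module_hom.add module_hom.zero module_hom.scale module_hom.sum)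

lemma poly_mapping_expansion:
  fixes v :: "tree \<Rightarrow>\<^sub>0 'k::field"
  shows "v = (\<Sum>T \<in> Poly_Mapping.keys v. scale (Poly_Mapping.lookup v T) (basis T))"
  by (rule poly_mapping_eqI)
    (simp add: lookup_sum basis_def lookup_single when_def in_keys_iff if_distrib cong: if_cong)

lemma tree_op_eqI: "(\<And>T. apply_op f (basis T) = apply_op g (basis T)) \<Longrightarrow> f = g"
  by (subst apply_op_inject[symmetric], rule ext,
      subst (1 2) poly_mapping_expansion, simp add: apply_op_hom)

lemma subspace_V_comp: "tree_space.subspace (V_comp j :: (tree \<Rightarrow>\<^sub>0 'k::field) set)"
  using keys_add by (fastforce simp: tree_space.subspace_def V_comp_def in_keys_iff)

lemma basis_V_comp: "int (tree_size T) = j \<Longrightarrow> basis T \<in> V_comp j"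
  by (simp add: V_comp_def basis_def)

lemma apply_op_V_comp:
  assumes "\<And>T. int (tree_size T) = j \<Longrightarrow> apply_op f (basis T) \<in> V_comp k" "v \<in> V_comp j"
  shows "apply_op f v \<in> V_comp k"
  using assms(1) assms(2)[unfolded V_comp_def] by (subst poly_mapping_expansion[of v])
    (auto simp: apply_op_hom intro!: tree_space.subspace_sum tree_space.subspace_scale subspace_V_comp)

section \<open>Recursion of the operators at the root\<close>

lemma up_op_basis: "apply_op (up_op j) (basis T) = (\<Sum>T' \<in> ups j T. basis T')"
  by (simp add: up_op_def)

lemma down_op_basis_down_tree:
  "apply_op (down_op i) (basis T) = (if i \<le> card (r_nodes T) then basis (down_tree i T) else 0)"
  by (simp add: down_op_basis down_tree_def)

text \<open>Grafting is made linear in the right subtree only: a down operator leaves the left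
  subtree fixed when the right one is nonempty, so sums over left subtrees can stay
  explicit.\<close>

definition node_op :: "tree \<Rightarrow> 'k::field tree_op" where
  "node_op L = linear_extension (\<lambda>R. basis (node L R))"

lemma node_op_basis [simp]: "apply_op (node_op L) (basis R) = basis (node L R)"
  by (simp add: node_op_def)

lemma tree_op_apply:
  "apply_op (f * g) v = apply_op f (apply_op g v)"
  "apply_op (f + g) v = apply_op f v + apply_op g v"
  "apply_op 0 v = 0"
  "apply_op 1 v = v"
  "apply_op (sum h A) v = (\<Sum>x\<in>A. apply_op (h x) v)"
proof -
  show "apply_op (sum h A) v = (\<Sum>x\<in>A. apply_op (h x) v)"
    by (induction A rule: infinite_finite_induct)
      (simp_all add: plus_tree_op.rep_eq zero_tree_op.rep_eq)
qed (simp_all add: times_tree_op.rep_eq plus_tree_op.rep_eq zero_tree_op.rep_eq one_tree_op.rep_eq)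

lemma up_op_empty_tree: "apply_op (up_op j) (basis empty_tree) = basis (left_chain j)"
  by (simp only: up_op_basis ups_empty_tree) simp

lemma up_op_node_op:
  "apply_op (up_op j) (apply_op (node_op L) v) =
     (\<Sum>a\<le>j. \<Sum>L' \<in> ups a L. apply_op (node_op L') (apply_op (up_op (j - a)) v))"
proof -
  \<comment> \<open>Checked on trees as an identity of operators, so that it also applies to vectors
    \<open>v\<close> such as the image of a tree under a down operator.\<close>
  have "up_op j * node_op L =
      ((\<Sum>a\<le>j. \<Sum>L' \<in> ups a L. node_op L' * up_op (j - a)) :: 'a tree_op)"
    by (rule tree_op_eqI) (simp add: tree_op_apply up_op_basis sum_ups_node apply_op_hom)
  from arg_cong[OF this, of "\<lambda>f. apply_op f v"] show ?thesis
    by (simp add: tree_op_apply)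
qed

lemma down_op_0: "down_op 0 = 1"
  by (rule tree_op_eqI) (simp add: down_op_basis_down_tree down_tree_node tree_op_apply)

lemma down_op_empty_tree:
  "apply_op (down_op i) (basis empty_tree) = (if i = 0 then basis empty_tree else 0)"
  by (simp add: down_op_basis_down_tree r_nodes_empty_tree down_tree_node)

lemma down_op_node_empty_tree:
  "apply_op (down_op (Suc i)) (basis (node L empty_tree)) = apply_op (down_op i) (basis L)"
  by (simp add: down_op_basis_down_tree card_r_nodes_node down_tree_node)

lemma down_op_node:
  "R \<noteq> empty_tree \<Longrightarrow>
     apply_op (down_op i) (basis (node L R)) = apply_op (node_op L) (apply_op (down_op i) (basis R))"
  by (simp add: down_op_basis_down_tree card_r_nodes_node down_tree_node apply_op_hom)

lemma down_op_left_chain: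
  "apply_op (down_op i) (basis (left_chain j)) = (if i \<le> j then basis (left_chain (j - i)) else 0)"
proof (induction j arbitrary: i)
  case 0
  then show ?case by (simp add: down_op_empty_tree)
next
  case (Suc j)
  then show ?case
    by (cases i) (auto simp: down_op_node_empty_tree down_op_0 tree_op_apply)
qed


section \<open>The commutation relation\<close>

text \<open>The trees produced by \<open>up_op j\<close> are split by the chain put into the empty
  right slot. If it is empty (\<open>a = j\<close>), the root is deleted and
  \<open>down_op i\<close> acts on the new left subtree: the last summand. Otherwise the deletions
  take place in the chain, the first of them at its root, which leaves \<open>down_op i\<close> of a
  chain of length \<open>j - 1 - a\<close>.\<close>

lemma down_op_up_op_node_empty_tree:
  "apply_op (down_op (Suc i)) (apply_op (up_op j) (basis (node L empty_tree))) =
     (if j = 0 then 0 else \<Sum>a\<le>j - 1. \<Sum>L' \<in> ups a L. apply_op (node_op L')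
        (apply_op (down_op i) (basis (left_chain (j - 1 - a))))) +
     (apply_op (down_op i) (apply_op (up_op j) (basis L)) :: tree \<Rightarrow>\<^sub>0 'k::field)"
proof -
  have up: "apply_op (up_op j) (basis (node L empty_tree)) =
      (\<Sum>a\<le>j. \<Sum>L' \<in> ups a L. (basis (node L' (left_chain (j - a))) :: tree \<Rightarrow>\<^sub>0 'k))" for j
    using up_op_node_op[of j L "basis empty_tree :: tree \<Rightarrow>\<^sub>0 'k"] by (simp add: up_op_empty_tree)
  have last: "apply_op (down_op i) (apply_op (up_op j) (basis L)) =
      (\<Sum>L' \<in> ups j L. apply_op (down_op (Suc i)) (basis (node L' empty_tree) :: tree \<Rightarrow>\<^sub>0 'k))"
    by (simp add: up_op_basis apply_op_hom down_op_node_empty_tree)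
  have step: "apply_op (down_op (Suc i)) (basis (node L' (left_chain (Suc n)))) =
      apply_op (node_op L') (apply_op (down_op i) (basis (left_chain n) :: tree \<Rightarrow>\<^sub>0 'k))" for L' n
    by (simp add: down_op_node down_op_node_empty_tree)
  show ?thesis
  proof (cases j)
    case 0
    then show ?thesis
      unfolding up last by (simp add: apply_op_hom)
  next
    case (Suc j')
    then show ?thesis
      unfolding up last
      by (simp add: apply_op_hom Suc_diff_le step del: left_chain.simps(2))
  qed
qed

lemma down_op_up_op_basis:
  "apply_op (down_op (Suc i)) (apply_op (up_op j) (basis T)) =
    (     apply_op (up_op j) (apply_op (down_op (Suc i)) (basis T)) +
     (if j = 0 then 0 else apply_op (down_op i) (apply_op (up_op (j - 1)) (basis T))) :: tree \<Rightarrow>\<^sub>0 'k::field)"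
proof (induction T arbitrary: i j rule: tree_induct)
  case empty_tree
  show ?case
    by (auto simp: up_op_empty_tree down_op_left_chain down_op_empty_tree apply_op_hom)
next
  case (node L R)
  show ?case
  proof (cases "R = empty_tree")
    case True
    \<comment> \<open>The contribution to
      \<open>D\<^sub>i\<^sub>+\<^sub>1 U\<^sub>j\<^sub>+\<^sub>1\<close> of the trees whose right
      slot received a nonempty chain.\<close>
    define S where "S i j = (\<Sum>a\<le>j. \<Sum>L' \<in> ups a L. apply_op (node_op L')
      (apply_op (down_op i) (basis (left_chain (j - a)) :: tree \<Rightarrow>\<^sub>0 'k)))" for i j
    have down_up: "apply_op (down_op (Suc i)) (apply_op (up_op j) (basis (node L empty_tree))) =
        (if j = 0 then 0 else S i (j - 1)) + apply_op (down_op i) (apply_op (up_op j) (basis L))" for i j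
      unfolding S_def by (rule down_op_up_op_node_empty_tree)
    have S_0: "S 0 j = apply_op (up_op j) (basis (node L empty_tree))" for j
      using up_op_node_op[of j L "basis empty_tree :: tree \<Rightarrow>\<^sub>0 'k"]
      by (simp add: S_def up_op_empty_tree down_op_0 tree_op_apply)
    \<comment> \<open>\<open>down_op (Suc i)\<close> kills the empty chain, which is the term
      \<open>a = j\<close>. On a longer chain it agrees with \<open>down_op i\<close> on the chain
      shortened by one node.\<close>
    have S_Suc: "S (Suc i) j = (if j = 0 then 0 else S i (j - 1))" for i j
      by (cases j) (auto simp: S_def down_op_left_chain down_op_empty_tree apply_op_hom Suc_diff_le
          intro!: sum.cong)
    \<comment> \<open>For \<open>i = 0\<close> the \<open>S\<close> term is
      \<open>up_op (j - 1)\<close> of the tree itself, by \<open>S_0\<close>. For a successor the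
      \<open>S\<close> terms on both sides agree by \<open>S_Suc\<close>, and what remains is the
      induction hypothesis for \<open>L\<close> with the index lowered by one.\<close>
    show ?thesis
      unfolding True down_up
      using node.IH(1)
      by (cases i) (simp_all add: down_op_0 tree_op_apply down_up down_op_node_empty_tree S_0 S_Suc)
  next
    case False
    \<comment> \<open>Every enlargement of \<open>R\<close> contains \<open>R\<close> and is
      nonempty, so the down operator acts in the right subtree alone; the relation for
      \<open>R\<close> can then be inserted in each summand.\<close>
    have comm: "apply_op (down_op i) (apply_op (up_op j) (basis (node L R))) =
        (\<Sum>a\<le>j. \<Sum>L' \<in> ups a L. apply_op (node_op L')
          (apply_op (down_op i) (apply_op (up_op (j - a)) (basis R)))
            :: tree \<Rightarrow>\<^sub>0 'k)" for i j
    proof -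
      have "R' \<noteq> empty_tree" if "R' \<in> ups a R" for a R'
        using that False by (auto simp: G_U_deg_def G_U_def nodes_eq_empty_iff)
      then show ?thesis
        using up_op_node_op[of j L "basis R :: tree \<Rightarrow>\<^sub>0 'k"]
        by (simp add: up_op_basis apply_op_hom down_op_node)
    qed
    show ?thesis
    proof (cases j)
      case 0
      then show ?thesis
        using False by (simp add: comm up_op_node_op down_op_node node.IH(2))
    next
      case (Suc j')
      then show ?thesis
        using False
        by (simp add: comm up_op_node_op down_op_node node.IH(2) apply_op_hom sum.distrib
            Suc_diff_le)
    qed
  qed
qed

lemma down_op_up_op_Suc:
  "down_op (Suc i) * up_op j =
     (up_op j * down_op (Suc i) + (if j = 0 then 0 else down_op i * up_op (j - 1)) :: 'k::field tree_op)"
  by (rule tree_op_eqI) (simp add: tree_op_apply down_op_up_op_basis)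

text \<open>Iterating the relation lowers both indices together until one reaches \<open>0\<close>.
  This is the coefficient form of multiplying by the geometric series in
  \<open>t t'\<close>.\<close>

lemma down_op_up_op:
  "down_op i * up_op j = (\<Sum>m\<le>min i j. up_op (j - m) * down_op (i - m) :: 'k::field tree_op)"
proof (induction i arbitrary: j)
  case 0
  then show ?case by (simp add: down_op_0)
next
  case (Suc i)
  show ?case
  proof (cases j)
    case 0
    then show ?thesis by (simp add: down_op_up_op_Suc)
  next
    case (Suc j')
    then show ?thesis
      by (simp add: down_op_up_op_Suc Suc.IH sum.atMost_Suc_shift del: sum.atMost_Suc)
  qed
qed

section \<open>Passage to generating functions, and degrees\<close>

lemma gen_down_op_gen_up_op:
  "gen_x (down_op :: nat \<Rightarrow> 'k::field tree_op) * gen_y up_op =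
     scalar_series (series_at (\<lambda>_. 1) (var_x * var_y)) * gen_y up_op * gen_x down_op"
proof (rule fps_ext, rule fps_ext)
  fix i j
  have scalar: "scalar_op (if P then 1 else 0) * f = (if P then f else 0)" for P and f :: "'k tree_op"
    by (cases P; transfer) auto
  let ?s = "scalar_series (series_at (\<lambda>_. 1) (var_x * var_y)) :: 'k tree_op fps fps"
  define ud where "ud = (gen_y up_op * gen_x down_op :: 'k tree_op fps fps)"
  have "(?s * ud) $ i $ j =
      (\<Sum>a\<le>i. \<Sum>b\<le>j. (if a = b then up_op (j - b) * down_op (i - a) else 0))"
  proof -
    have "ud $ a $ b = up_op b * down_op a" for a b
      by (simp add: ud_def nth_gen_prod)
    then show ?thesis
      by (auto simp: fps_mult_nth fps_sum_nth scalar_series_def nth_series_at scalar 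
          atLeast0AtMost intro!: sum.cong)
  qed
  \<comment> \<open>The scalar series is diagonal, so only \<open>b = a\<close> survives, and that
    index occurs in the inner sum exactly when \<open>a \<le> j\<close>.\<close>
  also have "\<dots> = (\<Sum>a\<le>i. if a \<le> j then up_op (j - a) * down_op (i - a) else 0)"
    by (rule sum.cong) auto
  also have "\<dots> = (\<Sum>a\<le>min i j. up_op (j - a) * down_op (i - a))"
    by (rule sum.mono_neutral_cong_right) auto
  finally show "(gen_x down_op * gen_y up_op) $ i $ j = (?s * gen_y up_op * gen_x down_op) $ i $ j"
    by (simp add: nth_gen_prod down_op_up_op mult.assoc ud_def)
qed

lemma up_op_V_comp: "apply_op (up_op i) ` V_comp j \<subseteq> V_comp (j + int i)"
proof (rule image_subsetI, rule apply_op_V_comp)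
  fix T assume "int (tree_size T) = j"
  then show "apply_op (up_op i) (basis T) \<in> V_comp (j + int i)"
    by (auto simp: up_op_basis G_U_deg_def intro!: tree_space.subspace_sum subspace_V_comp basis_V_comp)
qed

lemma down_op_V_comp: "apply_op (down_op i) ` V_comp j \<subseteq> V_comp (j - int i)"
proof (rule image_subsetI, rule apply_op_V_comp)
  fix T assume "int (tree_size T) = j"
  then show "apply_op (down_op i) (basis T) \<in> V_comp (j - int i)"
    using tree_size_down_tree[of i T]
    by (auto simp: down_op_basis_down_tree tree_space.subspace_0 subspace_V_comp intro!: basis_V_comp)
qed

theorem theorem4p1:
  shows "gen_x (down_op :: nat \<Rightarrow> 'k::field_char_0 tree_op) * gen_y up_op =
        scalar_series (1 / (1 - var_x * var_y)) * gen_y up_op * gen_x down_op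
    \<and> generalized_schur_operators
        (down_op :: nat \<Rightarrow> 'k::field_char_0 tree_op) up_op (\<lambda>_. 1)"
  by (auto simp: generalized_schur_operators_def inverse_one_minus_var_xy gen_down_op_gen_up_op
      intro: up_op_V_comp[THEN subsetD] down_op_V_comp[THEN subsetD])

end
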